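(* Let $D$ be a pre-divergence on a Polish space $\mathcal{X}$, $c$ a cost function, and $\mu,\nu\in\mathcal{P}(\mathcal{X})$. If the map $P\mapsto D(P\|\mu)$ is lower semicontinuous and has compact sublevel sets (i.e. $\{P:D(P\|\mu)\leq M\}$ is compact for every $M\in\mathbb{R}$), then there exists $\eta_*\in\mathcal{P}(\mathcal{X})$ with \[D^c(\nu\|\mu)=D(\eta_*\|\mu)+C(\eta_*,\nu).\] If in addition $P\mapsto D(P\|\mu)$ is strictly convex on the set where it is finite and $D^c(\nu\|\mu)<\infty$, then this $\eta_*$ is unique.
   Context: $\mathcal{P}(\mathcal{X})$ is the set of Borel probability measures on the Polish space $\mathcal{X}$ with the weak (Prokhorov) topology. A pre-divergence is $D:\mathcal{P}(\mathcal{X})\times\mathcal{P}(\mathcal{X})\to[0,\infty]$ with $D(\mu\|\mu)=0$ for all $\mu$. A cost function is a lower semicontinuous $c:\mathcal{X}\times\mathcal{X}\to[0,\infty]$, with OT cost $C(\mu,\nu)=\inf\{\int c\,d\pi:\pi_1=\mu,\pi_2=\nu\}$. $D^c(\nu\|\mu)=\inf_{\eta\in\mathcal{P}(\mathcal{X})}\{D(\eta\|\mu)+C(\eta,\nu)\}$. *)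

theory Defs
  imports "HOL-Probability.Probability"
begin

definition prob_measures :: "('a::topological_space) measure set" where
  "prob_measures = {P. sets P = sets borel \<and> prob_space P}"

definition weak_topology :: "('a::topological_space) measure topology" where
  "weak_topology = topology_generated_by
     {{P \<in> prob_measures. (\<integral>x. f x \<partial>P) \<in> U} | f U.
        continuous_on UNIV (f :: 'a \<Rightarrow> real) \<and> bounded (range f) \<and> open U}"

definition pre_divergence :: "('a::topological_space measure \<Rightarrow> 'a measure \<Rightarrow> ennreal) \<Rightarrow> bool" where
  "pre_divergence D \<longleftrightarrow> (\<forall>\<mu>\<in>prob_measures. D \<mu> \<mu> = 0)"

definition lsc_on :: "'b topology \<Rightarrow> ('b \<Rightarrow> ennreal) \<Rightarrow> bool" where
  "lsc_on T f \<longleftrightarrow> (\<forall>t. closedin T {x \<in> topspace T. f x \<le> t})"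

definition cost_function :: "('a::topological_space \<times> 'a \<Rightarrow> ennreal) \<Rightarrow> bool" where
  "cost_function c \<longleftrightarrow> lsc_on euclidean c"

definition couplings :: "'a::topological_space measure \<Rightarrow> 'a measure \<Rightarrow> ('a \<times> 'a) measure set" where
  "couplings \<mu> \<nu> = {\<pi>. sets \<pi> = sets borel \<and> prob_space \<pi> \<and>
      distr \<pi> borel fst = \<mu> \<and> distr \<pi> borel snd = \<nu>}"

definition OT_cost :: "('a::topological_space \<times> 'a \<Rightarrow> ennreal) \<Rightarrow> 'a measure \<Rightarrow> 'a measure \<Rightarrow> ennreal" where
  "OT_cost c \<mu> \<nu> = (INF \<pi>\<in>couplings \<mu> \<nu>. \<integral>\<^sup>+ z. c z \<partial>\<pi>)"

definition D_c :: "('a::topological_space measure \<Rightarrow> 'a measure \<Rightarrow> ennreal) \<Rightarrow>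
    ('a \<times> 'a \<Rightarrow> ennreal) \<Rightarrow> 'a measure \<Rightarrow> 'a measure \<Rightarrow> ennreal" where
  "D_c D c \<nu> \<mu> = (INF \<eta>\<in>prob_measures. D \<eta> \<mu> + OT_cost c \<eta> \<nu>)"

definition mix_measure :: "real \<Rightarrow> 'a::topological_space measure \<Rightarrow> 'a measure \<Rightarrow> 'a measure" where
  "mix_measure t P Q = measure_of UNIV (sets borel)
      (\<lambda>A. ennreal t * emeasure P A + ennreal (1 - t) * emeasure Q A)"

definition strictly_convex_on_finite :: "('a::topological_space measure \<Rightarrow> ennreal) \<Rightarrow> bool" where
  "strictly_convex_on_finite F \<longleftrightarrow>
     (\<forall>P\<in>prob_measures. \<forall>Q\<in>prob_measures. \<forall>t::real.
        F P < \<infinity> \<and> F Q < \<infinity> \<and> P \<noteq> Q \<and> 0 < t \<and> t < 1 \<longrightarrow>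
        F (mix_measure t P Q) < ennreal t * F P + ennreal (1 - t) * F Q)"

end

(*
The point is that \<open>\<eta> \<mapsto> C(\<eta>, \<nu>)\<close> is weakly lower semicontinuous; given this, \<open>D + C\<close> is
lower semicontinuous and attains its infimum on a compact sublevel set of D, and uniqueness follows
because C is convex under mixing of couplings.

For the semicontinuity, no Prokhorov theorem is needed, since the marginals of the limit coupling
are known beforehand. Take a countable base of balls whose boundaries are null for \<open>\<eta>\<close> and \<open>\<nu>\<close>,
and couplings \<open>\<pi>\<^sub>n\<close> of \<open>\<eta>\<^sub>n\<close> and \<open>\<nu>\<close>, where \<open>liminf \<eta>\<^sub>n(V) \<ge> \<eta>(V)\<close> for open V. Along a subsequence
\<open>\<pi>\<^sub>n\<close> converges on the countable algebra generated by the cylinders over the base. The limit is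
continuous at the empty set: by inner regularity of \<open>\<eta>\<close> and \<open>\<nu>\<close> there is a compact rectangle of
almost full mass on which all sets of the algebra are relatively clopen. Caratheodory's theorem
gives the limit coupling, and the layer cake formula with Fatou's lemma gives the inequality of the
costs. Sequences suffice, without first countability of the weak topology, because
only countably many open conditions on \<open>\<eta>\<^sub>n\<close> are used.
*)
theory Submission
  imports Defs
begin

section \<open>Probability measures, couplings and their marginals\<close>

lemma topspace_weak_topology [simp]: "topspace weak_topology = prob_measures"
proof -
  have "prob_measures \<subseteq> \<Union>{{P \<in> prob_measures. (\<integral>x. f x \<partial>P) \<in> U} | f U.
        continuous_on UNIV (f :: 'a \<Rightarrow> real) \<and> bounded (range f) \<and> open U}"
    by (intro Union_upper CollectI exI[of _ "\<lambda>_. 0"] exI[of _ UNIV]) auto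
  then show ?thesis
    unfolding weak_topology_def topology_generated_by_topspace by blast
qed

lemma prob_measuresD:
  assumes "P \<in> prob_measures"
  shows "sets P = sets borel" "prob_space P" "space P = UNIV"
  using assms sets_eq_imp_space_eq[of P borel] by (auto simp: prob_measures_def)

lemma couplingsD:
  assumes "\<pi> \<in> couplings \<mu> \<nu>"
  shows "sets \<pi> = sets borel" "prob_space \<pi>" "space \<pi> = UNIV"
    "distr \<pi> borel fst = \<mu>" "distr \<pi> borel snd = \<nu>"
  using assms sets_eq_imp_space_eq[of \<pi> borel] by (auto simp: couplings_def)

lemma emeasure_distr_fst:
  fixes \<pi> :: "('a::topological_space \<times> 'a) measure"
  assumes \<pi>: "sets \<pi> = sets borel" and A: "A \<in> sets borel"
  shows "emeasure (distr \<pi> borel fst) A = emeasure \<pi> (A \<times> UNIV)"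
proof -
  have "fst \<in> measurable \<pi> borel"
    unfolding measurable_cong_sets[OF \<pi> refl]
    by (intro borel_measurable_continuous_onI continuous_intros)
  moreover have "fst -` A \<inter> space \<pi> = A \<times> UNIV"
    using sets_eq_imp_space_eq[OF \<pi>] by auto
  ultimately show ?thesis using A by (simp add: emeasure_distr)
qed

lemma emeasure_distr_snd:
  fixes \<pi> :: "('a::topological_space \<times> 'a) measure"
  assumes \<pi>: "sets \<pi> = sets borel" and A: "A \<in> sets borel"
  shows "emeasure (distr \<pi> borel snd) A = emeasure \<pi> (UNIV \<times> A)"
proof -
  have "snd \<in> measurable \<pi> borel"
    unfolding measurable_cong_sets[OF \<pi> refl]
    by (intro borel_measurable_continuous_onI continuous_intros)
  moreover have "snd -` A \<inter> space \<pi> = UNIV \<times> A"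
    using sets_eq_imp_space_eq[OF \<pi>] by auto
  ultimately show ?thesis using A by (simp add: emeasure_distr)
qed

lemma emeasure_coupling_fst:
  assumes "\<pi> \<in> couplings \<mu> \<nu>" "A \<in> sets borel"
  shows "emeasure \<pi> (A \<times> UNIV) = emeasure \<mu> A"
  using emeasure_distr_fst[OF couplingsD(1)[OF assms(1)] assms(2)] couplingsD(4)[OF assms(1)] by simp

lemma emeasure_coupling_snd:
  assumes "\<pi> \<in> couplings \<mu> \<nu>" "A \<in> sets borel"
  shows "emeasure \<pi> (UNIV \<times> A) = emeasure \<nu> A"
  using emeasure_distr_snd[OF couplingsD(1)[OF assms(1)] assms(2)] couplingsD(5)[OF assms(1)] by simp

section \<open>Comparison of measures on open sets\<close>

text \<open>Increasing finite unions of members of \<open>G\<close> stay in \<open>G\<close> and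
  exhaust \<open>V\<close>, so continuity from below carries the inequality from \<open>G\<close> to
  \<open>V\<close>. It serves both for sequences of measures and, with \<open>N\<close> constant,
  for comparing two measures.\<close>

lemma emeasure_le_liminf_if_base:
  assumes "countable G" "{} \<in> G" "\<And>A B. A \<in> G \<Longrightarrow> B \<in> G \<Longrightarrow> A \<union> B \<in> G"
    and sets: "G \<subseteq> sets M" "\<And>n. sets (N n) = sets M"
    and le: "\<And>A. A \<in> G \<Longrightarrow> emeasure M A \<le> liminf (\<lambda>n. emeasure (N n) A)"
    and V: "V = \<Union>{A \<in> G. A \<subseteq> V}"
  shows "emeasure M V \<le> liminf (\<lambda>n. emeasure (N n) V)"
proof -
  let ?G = "{A \<in> G. A \<subseteq> V}"
  \<comment> \<open>The empty set keeps the family nonempty, so that \<open>from_nat_into\<close>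
    enumerates exactly its members.\<close>
  have G: "?G \<noteq> {}" "countable ?G" using assms(1,2) by auto
  define R where "R k = (\<Union>j\<le>k. from_nat_into ?G j)" for k
  have R: "R k \<in> G" "R k \<subseteq> V" for k
  proof -
    have *: "from_nat_into ?G j \<in> ?G" for j using from_nat_into[OF G(1)] .
    show "R k \<subseteq> V" using * by (auto simp: R_def)
    show "R k \<in> G"
    proof (induction k)
      case 0 then show ?case using * by (simp add: R_def)
    next
      case (Suc k)
      then show ?case using assms(3)[OF Suc, of "from_nat_into ?G (Suc k)"] *[of "Suc k"]
        by (simp add: R_def atMost_Suc Un_commute)
    qed
  qed
  have UR: "(\<Union>k. R k) = V"
  proof -
    have "(\<Union>k. R k) = \<Union>(range (from_nat_into ?G))" by (auto simp: R_def)
    then show ?thesis using range_from_nat_into[OF G] V by simp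
  qed
  have "range R \<subseteq> sets M" using R(1) sets(1) by auto
  moreover have "incseq R" by (force simp: R_def incseq_def)
  ultimately have "emeasure M V = (SUP k. emeasure M (R k))"
    using SUP_emeasure_incseq[of R M] UR by simp
  also have "\<dots> \<le> liminf (\<lambda>n. emeasure (N n) V)"
  proof (rule SUP_least)
    fix k
    have "V \<in> sets M" using \<open>range R \<subseteq> sets M\<close> UR by (metis sets.countable_UN)
    have "emeasure M (R k) \<le> liminf (\<lambda>n. emeasure (N n) (R k))" using le R(1) by blast
    also have "\<dots> \<le> liminf (\<lambda>n. emeasure (N n) V)"
      by (intro Liminf_mono always_eventually allI emeasure_mono R) (simp add: sets \<open>V \<in> sets M\<close>)
    finally show "emeasure M (R k) \<le> liminf (\<lambda>n. emeasure (N n) V)" .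
  qed
  finally show ?thesis .
qed

text \<open>Outer regularity extends the inequality to all Borel sets. Applied to a set and to its
  complement, it becomes an equality because both total masses are 1.\<close>

lemma prob_measure_eqI_le_open:
  fixes M N :: "'a::polish_space measure"
  assumes M: "M \<in> prob_measures" and N: "N \<in> prob_measures"
    and le: "\<And>V. open V \<Longrightarrow> emeasure M V \<le> emeasure N V"
  shows "M = N"
proof -
  note DM = prob_measuresD[OF M] and DN = prob_measuresD[OF N]
  interpret M: prob_space M by (rule DM)
  interpret N: prob_space N by (rule DN)
  have *: "emeasure M A \<le> emeasure N A" if A: "A \<in> sets borel" for A
  proof -
    have "emeasure M A \<le> emeasure N V" if "A \<subseteq> V" "open V" for V
    proof -
      have "emeasure M A \<le> emeasure M V"
        using that DM(1) by (intro emeasure_mono) auto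
      then show ?thesis using le[OF that(2)] by simp
    qed
    then show ?thesis
      by (subst outer_regular[OF DN(1) _ A]) (auto intro!: INF_greatest)
  qed
  show ?thesis
  proof (rule measure_eqI)
    show "sets M = sets N" using DM DN by simp
    fix A assume "A \<in> sets M"
    then have A: "A \<in> sets borel" "UNIV - A \<in> sets borel" using DM by auto
    have "measure M A \<le> measure N A" "measure M (UNIV - A) \<le> measure N (UNIV - A)"
      using *[OF A(1)] *[OF A(2)] by (auto simp: M.emeasure_eq_measure N.emeasure_eq_measure)
    moreover have "measure M (UNIV - A) = 1 - measure M A" "measure N (UNIV - A) = 1 - measure N A"
      using M.prob_compl[of A] N.prob_compl[of A] A DM DN by auto
    ultimately show "emeasure M A = emeasure N A"
      by (simp add: M.emeasure_eq_measure N.emeasure_eq_measure)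
  qed
qed

section \<open>Layer cake formula and integrals of lower semicontinuous functions\<close>

lemma emeasure_lborel_below_ennreal: "emeasure lborel {t::real. 0 \<le> t \<and> ennreal t < x} = x"
proof (cases x)
  case (real r)
  then have "{t::real. 0 \<le> t \<and> ennreal t < x} = {0..<r}"
    by (auto simp: ennreal_less_iff)
  then show ?thesis using real by simp
next
  case top
  then have "{t::real. 0 \<le> t \<and> ennreal t < x} = {0..}" by auto
  moreover have "emeasure lborel {0::real..} = \<infinity>"
  proof (rule ccontr)
    assume "emeasure lborel {0::real..} \<noteq> \<infinity>"
    then obtain r where r: "0 \<le> r" "emeasure lborel {0::real..} = ennreal r"
      by (cases "emeasure lborel {0::real..}") auto
    have "emeasure lborel {0..r + 1} \<le> emeasure lborel {0::real..}"
      by (intro emeasure_mono) auto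
    then show False using r by simp
  qed
  ultimately show ?thesis using top by simp
qed

lemma measurable_emeasure_superlevel:
  assumes "sigma_finite_measure M" and [measurable]: "f \<in> borel_measurable M"
  shows "(\<lambda>t. emeasure M {z \<in> space M. ennreal t < f z}) \<in> borel_measurable borel"
proof -
  interpret sigma_finite_measure M by fact
  have "(\<lambda>t. \<integral>\<^sup>+ z. indicator {z \<in> space M. ennreal t < f z} z \<partial>M) \<in> borel_measurable borel"
    by measurable
  moreover have "(\<integral>\<^sup>+ z. indicator {z \<in> space M. ennreal t < f z} z \<partial>M)
      = emeasure M {z \<in> space M. ennreal t < f z}" for t
    by (subst nn_integral_indicator) measurable
  ultimately show ?thesis by simp
qed

text \<open>The value \<open>f z\<close> is the length of the set of real levels
  \<open>t \<ge> 0\<close> below it, also when it is infinite. Tonelli's theorem on the region under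
  the graph then swaps points and levels.\<close>

lemma nn_integral_layer_cake:
  assumes "sigma_finite_measure M" and [measurable]: "f \<in> borel_measurable M"
  shows "(\<integral>\<^sup>+ z. f z \<partial>M) = (\<integral>\<^sup>+ t. indicator {0..} t * emeasure M {z \<in> space M. ennreal t < f z} \<partial>lborel)"
proof -
  interpret M: sigma_finite_measure M by fact
  interpret pair_sigma_finite M lborel ..
  define S where "S = (\<lambda>z t::real. indicator {t. 0 \<le> t \<and> ennreal t < f z} t :: ennreal)"
  have [measurable]: "case_prod S \<in> borel_measurable (M \<Otimes>\<^sub>M lborel)"
    unfolding S_def by measurable
  have "(\<integral>\<^sup>+ z. f z \<partial>M) = (\<integral>\<^sup>+ z. (\<integral>\<^sup>+ t. S z t \<partial>lborel) \<partial>M)"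
  proof (intro nn_integral_cong)
    fix z
    have "{t::real. 0 \<le> t \<and> ennreal t < f z} \<in> sets lborel" by measurable
    then show "f z = (\<integral>\<^sup>+ t. S z t \<partial>lborel)"
      by (simp add: S_def emeasure_lborel_below_ennreal)
  qed
  also have "\<dots> = (\<integral>\<^sup>+ t. (\<integral>\<^sup>+ z. S z t \<partial>M) \<partial>lborel)"
    by (rule Fubini'[symmetric]) measurable
  also have "\<dots> = (\<integral>\<^sup>+ t. indicator {0..} t * emeasure M {z \<in> space M. ennreal t < f z} \<partial>lborel)"
  proof (intro nn_integral_cong)
    fix t :: real
    have "(\<integral>\<^sup>+ z. S z t \<partial>M) = (\<integral>\<^sup>+ z. indicator {0..} t * indicator {z \<in> space M. ennreal t < f z} z \<partial>M)"
      by (intro nn_integral_cong) (auto simp: S_def indicator_def)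
    also have "\<dots> = indicator {0..} t * emeasure M {z \<in> space M. ennreal t < f z}"
      by (subst nn_integral_cmult_indicator) auto
    finally show "(\<integral>\<^sup>+ z. S z t \<partial>M) = indicator {0..} t * emeasure M {z \<in> space M. ennreal t < f z}" .
  qed
  finally show ?thesis .
qed

lemma lsc_on_euclidean_open:
  assumes "lsc_on euclidean f"
  shows "open {z. t < f z}"
proof -
  have "closed {z. f z \<le> t}" using assms by (simp add: lsc_on_def)
  moreover have "{z. t < f z} = - {z. f z \<le> t}" by auto
  ultimately show ?thesis by (simp add: open_Compl)
qed

lemma borel_measurable_lsc_on:
  assumes "lsc_on euclidean f" "sets M = sets borel"
  shows "f \<in> borel_measurable M"
  by (rule borel_measurableI_greater)
    (simp add: assms sets_eq_imp_space_eq[OF assms(2)] lsc_on_euclidean_open[OF assms(1)])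

text \<open>Strict superlevel sets of \<open>f\<close> are open, so \<open>le\<close> applies at
  every level \<open>t\<close>. The layer cake formula turns integrals into integrals over
  \<open>t\<close>, where Fatou's lemma moves the liminf outside.\<close>

lemma nn_integral_lsc_le_liminf:
  fixes f :: "'b::topological_space \<Rightarrow> ennreal"
  assumes f: "lsc_on euclidean f"
    and M: "M \<in> prob_measures" and N: "\<And>n::nat. N n \<in> prob_measures"
    and le: "\<And>V. open V \<Longrightarrow> emeasure M V \<le> liminf (\<lambda>n. emeasure (N n) V)"
  shows "(\<integral>\<^sup>+ z. f z \<partial>M) \<le> liminf (\<lambda>n. \<integral>\<^sup>+ z. f z \<partial>N n)"
proof -
  have meas: "f \<in> borel_measurable P" if "P \<in> prob_measures" for P
    using borel_measurable_lsc_on[OF f] prob_measuresD[OF that] by blast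
  have cake: "(\<integral>\<^sup>+ z. f z \<partial>P) = (\<integral>\<^sup>+ t. indicator {0..} t * emeasure P {z. ennreal t < f z} \<partial>lborel)"
    if "P \<in> prob_measures" for P
    using nn_integral_layer_cake[OF _ meas[OF that]] prob_measuresD[OF that]
    by (simp add: prob_space_imp_sigma_finite)
  have [measurable]: "(\<lambda>t. emeasure P {z. ennreal t < f z}) \<in> borel_measurable borel"
    if "P \<in> prob_measures" for P
    using measurable_emeasure_superlevel[OF _ meas[OF that]] prob_measuresD[OF that]
    by (simp add: prob_space_imp_sigma_finite)
  have "(\<integral>\<^sup>+ z. f z \<partial>M) \<le> (\<integral>\<^sup>+ t. liminf (\<lambda>n. indicator {0..} t * emeasure (N n) {z. ennreal t < f z}) \<partial>lborel)"
    unfolding cake[OF M]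
  proof (intro nn_integral_mono)
    fix t :: real
    show "indicator {0..} t * emeasure M {z. ennreal t < f z}
        \<le> liminf (\<lambda>n. indicator {0..} t * emeasure (N n) {z. ennreal t < f z})"
      using le[OF lsc_on_euclidean_open[OF f, of "ennreal t"]] by (simp add: indicator_def)
  qed
  also have "\<dots> \<le> liminf (\<lambda>n. \<integral>\<^sup>+ t. indicator {0..} t * emeasure (N n) {z. ennreal t < f z} \<partial>lborel)"
    using N by (intro nn_integral_liminf) simp
  finally show ?thesis using cake[OF N] by simp
qed

section \<open>Weakly open conditions on the mass of open sets\<close>

text \<open>This is the open-set half of the portmanteau theorem. A compact \<open>K\<close> inside
  \<open>V\<close> still has mass above \<open>a\<close>, and a Urysohn function between
  \<open>K\<close> and the complement of \<open>V\<close> has an integral lying between the masses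
  of \<open>K\<close> and \<open>V\<close>.\<close>

lemma openin_weak_topology_emeasure_greater:
  fixes V :: "'a::polish_space set"
  assumes "open V"
  shows "openin weak_topology {P \<in> prob_measures. a < emeasure P V}"
proof -
  have "\<exists>T. openin weak_topology T \<and> P \<in> T \<and> T \<subseteq> {P \<in> prob_measures. a < emeasure P V}"
    if P: "P \<in> prob_measures" and a: "a < emeasure P V" for P
  proof -
    note DP = prob_measuresD[OF P]
    interpret P: prob_space P by (rule DP)
    have "emeasure P V = (SUP K \<in> {K. K \<subseteq> V \<and> compact K}. emeasure P K)"
      using assms by (intro inner_regular DP) auto
    with a obtain K where K: "K \<subseteq> V" "compact K" "a < emeasure P K"
      by (auto simp: less_SUP_iff)
    obtain f where f: "continuous_map euclidean (top_of_set {0..1::real}) f" "f ` (- V) \<subseteq> {0}" "f ` K \<subseteq> {1}"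
    proof (rule Urysohn_lemma[of euclidean "- V" K "0::real" 1])
      show "normal_space (euclidean :: 'a topology)"
        by (intro metrizable_imp_normal_space metrizable_space_euclidean)
    qed (use assms K in \<open>auto simp: disjnt_def compact_imp_closed\<close>)
    then have cf: "continuous_on UNIV f" and f01: "\<And>x. 0 \<le> f x \<and> f x \<le> 1"
      by (auto simp: continuous_map_in_subtopology)
    have fK: "f x = 1" if "x \<in> K" for x using f(3) that by auto
    have fV: "f x = 0" if "x \<notin> V" for x using f(2) that by auto
    have bf: "bounded (range f)" by (intro boundedI[of _ 1]) (use f01 in auto)
    have fm: "f \<in> borel_measurable Q" if "Q \<in> prob_measures" for Q
      using borel_measurable_continuous_onI[OF cf] prob_measuresD(1)[OF that] by (metis measurable_cong_sets)
    have int: "(\<integral>\<^sup>+x. ennreal (f x) \<partial>Q) = ennreal (\<integral>x. f x \<partial>Q)" if "Q \<in> prob_measures" for Q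
    proof -
      interpret Q: prob_space Q using prob_measuresD[OF that] by simp
      have "integrable Q f"
        by (rule Q.integrable_const_bound[of _ 1]) (use f01 fm[OF that] in auto)
      then show ?thesis using f01 by (intro nn_integral_eq_integral) auto
    qed
    have "emeasure P K \<le> (\<integral>\<^sup>+x. ennreal (f x) \<partial>P)"
    proof -
      have "K \<in> sets P" using DP(1) K(2) by (simp add: compact_imp_closed)
      then have "emeasure P K = (\<integral>\<^sup>+x. indicator K x \<partial>P)" by simp
      also have "\<dots> \<le> (\<integral>\<^sup>+x. ennreal (f x) \<partial>P)"
        by (intro nn_integral_mono) (auto simp: indicator_def fK)
      finally show ?thesis .
    qed
    with K(3) int[OF P] have aP: "a < ennreal (\<integral>x. f x \<partial>P)" by simp
    \<comment> \<open>The generating sets of the topology constrain real integrals, hence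
      \<open>enn2real a\<close>; this loses nothing because \<open>a\<close> lies below a finite
      integral.\<close>
    let ?W = "{Q \<in> prob_measures. (\<integral>x. f x \<partial>Q) \<in> {enn2real a<..}}"
    have afin: "a < \<infinity>" using aP less_top_ennreal by (metis ennreal_less_top infinity_ennreal_def order.strict_trans)
    have "openin weak_topology ?W"
      unfolding weak_topology_def
      by (rule topology_generated_by_Basis)
        (use cf bf in \<open>auto intro!: exI[of _ f] exI[of _ "{enn2real a<..}"]\<close>)
    moreover have "P \<in> ?W"
      using P aP afin by (cases a) (auto simp: ennreal_less_iff)
    moreover have "?W \<subseteq> {P \<in> prob_measures. a < emeasure P V}"
    proof
      fix Q assume "Q \<in> ?W"
      then have Q: "Q \<in> prob_measures" "(\<integral>x. f x \<partial>Q) \<in> {enn2real a<..}" by auto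
      have VQ: "V \<in> sets Q" using prob_measuresD(1)[OF Q(1)] assms by simp
      have "a < ennreal (\<integral>x. f x \<partial>Q)"
        using Q(2) afin by (cases a) (auto simp: ennreal_less_iff)
      also have "\<dots> = (\<integral>\<^sup>+x. ennreal (f x) \<partial>Q)" using int Q by simp
      also have "\<dots> \<le> (\<integral>\<^sup>+x. indicator V x \<partial>Q)"
        using f01 fV by (intro nn_integral_mono) (auto simp: indicator_def ennreal_le_1)
      finally show "Q \<in> {P \<in> prob_measures. a < emeasure P V}" using VQ Q(1) by simp
    qed
    ultimately show ?thesis by blast
  qed
  then show ?thesis by (subst openin_subopen) blast
qed

section \<open>A countable base with null frontiers\<close>

text \<open>Spheres about \<open>d\<close> are the fibres of \<open>dist d\<close>, so the charged
  radii are the atoms of a finite image measure on the reals.\<close>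

lemma countable_charged_spheres:
  fixes M :: "'a::metric_space measure"
  assumes "finite_measure M" "sets M = sets borel"
  shows "countable {r. emeasure M (sphere d r) \<noteq> 0}"
proof -
  interpret finite_measure M by fact
  have m: "dist d \<in> measurable M borel"
    unfolding measurable_cong_sets[OF assms(2) refl]
    by (intro borel_measurable_continuous_onI continuous_intros)
  interpret D: finite_measure "distr M borel (dist d)"
    using m by (rule finite_measure_distr)
  have "measure (distr M borel (dist d)) {r} = measure M (sphere d r)" for r
  proof -
    have "dist d -` {r} \<inter> space M = sphere d r"
      using sets_eq_imp_space_eq[OF assms(2)] by auto
    then show ?thesis using m by (simp add: measure_distr)
  qed
  then show ?thesis using D.countable_support by (simp add: emeasure_eq_measure)
qed

text \<open>The base consists of balls about a countable dense set. Only countably many radii are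
  charged at each centre, so every nonempty open interval contains an admissible one.\<close>

lemma null_frontier_baseE:
  fixes \<eta> \<nu> :: "'a::polish_space measure"
  assumes "finite_measure \<eta>" "sets \<eta> = sets borel" "finite_measure \<nu>" "sets \<nu> = sets borel"
  obtains B :: "nat \<Rightarrow> 'a set" where
    "\<And>n. open (B n)" "\<And>n. emeasure \<eta> (frontier (B n)) = 0" "\<And>n. emeasure \<nu> (frontier (B n)) = 0"
    "\<And>U x. open U \<Longrightarrow> x \<in> U \<Longrightarrow> \<exists>n. x \<in> B n \<and> B n \<subseteq> U"
proof -
  obtain D :: "'a set" where D: "countable D" "\<And>U. open U \<Longrightarrow> U \<noteq> {} \<Longrightarrow> \<exists>d\<in>D. d \<in> U"
    using countable_dense_setE by blast
  define S where "S d = {r. emeasure \<eta> (sphere d r) \<noteq> 0} \<union> {r. emeasure \<nu> (sphere d r) \<noteq> 0}" for d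
  \<comment> \<open>The lower bound puts \<open>x\<close> into the ball of any centre closer than
    \<open>inverse (real (k + 2))\<close>; the upper bound keeps that ball inside a prescribed
    neighbourhood of \<open>x\<close>.\<close>
  have ex: "\<exists>r. inverse (real (k + 2)) < r \<and> r < inverse (real (k + 1)) \<and> r \<notin> S d" for d k
  proof -
    have "countable (S d)"
      unfolding S_def by (intro countable_Un countable_charged_spheres assms)
    moreover have "{inverse (real (k + 2)) <..< inverse (real (k + 1))} \<noteq> {}"
      by (simp add: field_simps)
    ultimately show ?thesis
      using open_minus_countable[of "S d" "{inverse (real (k + 2)) <..< inverse (real (k + 1))}"] by auto
  qed
  define r where "r d k = (SOME r. inverse (real (k + 2)) < r \<and> r < inverse (real (k + 1)) \<and> r \<notin> S d)" for d k
  have r: "inverse (real (k + 2)) < r d k" "r d k < inverse (real (k + 1))" "r d k \<notin> S d" for d k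
    using someI_ex[OF ex[of k d]] by (simp_all add: r_def)
  define \<B> where "\<B> = (\<lambda>(d, k). ball d (r d k)) ` (D \<times> (UNIV :: nat set))"
  have base: "\<exists>b\<in>\<B>. x \<in> b \<and> b \<subseteq> U" if U: "open U" "x \<in> U" for U x
  proof -
    obtain e where e: "0 < e" "ball x e \<subseteq> U" using U open_contains_ball by blast
    obtain k where k: "inverse (real (k + 1)) < e / 2"
      using reals_Archimedean[of "e / 2"] e by auto
    obtain d where d: "d \<in> D" "dist x d < inverse (real (k + 2))"
      using D(2)[of "ball x (inverse (real (k + 2)))"] by (auto simp: mem_ball)
    have "x \<in> ball d (r d k)" using d r(1)[of k d] by (simp add: dist_commute)
    moreover have "ball d (r d k) \<subseteq> ball x e"
    proof
      fix y assume "y \<in> ball d (r d k)"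
      then have "dist d y < e / 2" using r(2)[of d k] k by simp
      moreover have "dist x d < e / 2" using d(2) r(1)[of k d] r(2)[of d k] k by simp
      ultimately show "y \<in> ball x e" using dist_triangle[of x y d] by simp
    qed
    ultimately show ?thesis using d(1) e(2) by (auto simp: \<B>_def)
  qed
  have ne: "\<B> \<noteq> {}" "countable \<B>"
    using base[of UNIV] D(1) by (auto simp: \<B>_def)
  have null: "emeasure M (frontier b) = 0"
    if b\<B>: "b \<in> \<B>" and M: "sets M = sets borel" and z: "\<And>d k. emeasure M (sphere d (r d k)) = 0" for b and M :: "'a measure"
  proof -
    obtain d k where b: "b = ball d (r d k)" using b\<B> by (auto simp: \<B>_def)
    have "sphere d (r d k) \<in> sets M" 
      unfolding M sphere_def by (intro borel_closed closed_Collect_eq continuous_intros)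
    moreover have "frontier b \<subseteq> sphere d (r d k)"
      using closure_minimal[OF ball_subset_cball closed_cball, of d "r d k"] unfolding b frontier_def by (auto simp: interior_open)
    ultimately show ?thesis using emeasure_eq_0 z by blast
  qed
  show ?thesis
  proof
    show "open (from_nat_into \<B> n)" for n
      using from_nat_into[OF ne(1), of n] by (auto simp: \<B>_def)
    show "emeasure \<eta> (frontier (from_nat_into \<B> n)) = 0" for n
      using r(3) by (intro null from_nat_into ne assms) (auto simp: S_def)
    show "emeasure \<nu> (frontier (from_nat_into \<B> n)) = 0" for n
      using r(3) by (intro null from_nat_into ne assms) (auto simp: S_def)
    show "\<exists>n. x \<in> from_nat_into \<B> n \<and> from_nat_into \<B> n \<subseteq> U" if "open U" "x \<in> U" for U x
      using base[OF that] range_from_nat_into[OF ne] by (metis rangeE)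
  qed
qed

section \<open>Subsequences and countable algebras\<close>

text \<open>The cube is compact by Tychonoff's theorem, and over a countable index the product is
  first countable, so compactness yields sequential compactness. This replaces an explicit diagonal
  argument.\<close>

lemma pointwise_convergent_subseqE:
  fixes m :: "nat \<Rightarrow> 'e::countable \<Rightarrow> real"
  assumes "\<And>n e. m n e \<in> {0..1}"
  obtains r l where "strict_mono (r :: nat \<Rightarrow> nat)" "\<And>e. (\<lambda>n. m (r n) e) \<longlonglongrightarrow> l e"
proof -
  have "compactin (product_topology (\<lambda>_::'e. euclidean) UNIV) (\<Pi>\<^sub>E e\<in>UNIV. {0..1::real})"
    by (simp add: compactin_PiE)
  then have "compact (\<Pi>\<^sub>E e\<in>(UNIV::'e set). {0..1::real})"
    by (simp add: euclidean_product_topology)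
  then have "seq_compact (\<Pi>\<^sub>E e\<in>(UNIV::'e set). {0..1::real})"
    by (rule compact_imp_seq_compact)
  moreover have "\<forall>n. m n \<in> (\<Pi>\<^sub>E e\<in>UNIV. {0..1})" using assms by auto
  ultimately obtain l r where r: "strict_mono (r :: nat \<Rightarrow> nat)" "(m \<circ> r) \<longlonglongrightarrow> l"
    unfolding seq_compact_def by metis
  have "(\<lambda>n. m (r n) e) \<longlonglongrightarrow> l e" for e
    using continuous_on_tendsto_compose[OF continuous_on_product_coordinates[of e] r(2)]
    by (simp add: o_def)
  then show ?thesis using r(1) that by blast
qed

text \<open>Expressions name the members of the algebra generated by a family. With countably many
  atoms there are countably many expressions, so the algebra is countable, and properties of its
  members follow by structural induction.\<close>

datatype 'i bool_expr = Atom 'i | Neg "'i bool_expr" | Disj "'i bool_expr" "'i bool_expr"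

instance bool_expr :: (countable) countable
  by countable_datatype

primrec bool_set :: "('i \<Rightarrow> 'b set) \<Rightarrow> 'i bool_expr \<Rightarrow> 'b set" where
  "bool_set A (Atom i) = A i"
| "bool_set A (Neg e) = - bool_set A e"
| "bool_set A (Disj e f) = bool_set A e \<union> bool_set A f"

lemma algebra_bool_set: "algebra UNIV (range (bool_set A))"
  unfolding algebra_iff_Un
proof (intro conjI ballI)
  show "{} \<in> range (bool_set A)"
    by (rule range_eqI[of _ _ "Neg (Disj e (Neg e))" for e]) auto
  fix a assume "a \<in> range (bool_set A)"
  then obtain e where e: "a = bool_set A e" by blast
  show "UNIV - a \<in> range (bool_set A)"
    by (rule range_eqI[of _ _ "Neg e"]) (auto simp: e)
  fix b assume "b \<in> range (bool_set A)"
  then obtain f where f: "b = bool_set A f" by blast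
  show "a \<union> b \<in> range (bool_set A)"
    by (rule range_eqI[of _ _ "Disj e f"]) (auto simp: e f)
qed auto

text \<open>Complements keep the frontier and unions do not leave the union of the frontiers. Thus
  one exceptional set serves the whole algebra.\<close>

lemma frontier_bool_set_subset: "frontier (bool_set A e) \<subseteq> (\<Union>i. frontier (A i))"
proof (induction e)
  case (Disj e f)
  then show ?case using frontier_Un_subset[of "bool_set A e" "bool_set A f"] by auto
qed auto

lemma bool_set_in_sets: "(\<And>i. A i \<in> sets borel) \<Longrightarrow> bool_set A e \<in> sets borel"
  by (induction e) (auto simp: borel_comp)

text \<open>Finite unions of base sets form a countable family closed under unions. The inequality
  for all open sets is thereby reduced to countably many conditions, which a single sequence can be
  made to satisfy.\<close>

lemma emeasure_open_le_liminf_if_finite_unions: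
  fixes B :: "nat \<Rightarrow> 'a::topological_space set"
  assumes \<eta>: "\<eta> \<in> prob_measures" and H: "\<And>n::nat. H n \<in> prob_measures"
    and B_open: "\<And>n. open (B n)"
    and B_base: "\<And>U x. open U \<Longrightarrow> x \<in> U \<Longrightarrow> \<exists>n. x \<in> B n \<and> B n \<subseteq> U"
    and le: "\<And>F. finite F \<Longrightarrow> emeasure \<eta> (\<Union>i\<in>F. B i) \<le> liminf (\<lambda>n. emeasure (H n) (\<Union>i\<in>F. B i))"
    and V: "open V"
  shows "emeasure \<eta> V \<le> liminf (\<lambda>n. emeasure (H n) V)"
proof (rule emeasure_le_liminf_if_base)
  let ?U = "(\<lambda>F. \<Union>i\<in>F. B i) ` {F. finite F}"
  show "countable ?U" by (intro countable_image countable_Collect_finite)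
  show "{} \<in> ?U" by (rule image_eqI[of _ _ "{}"]) auto
  show "X \<union> Y \<in> ?U" if XY: "X \<in> ?U" "Y \<in> ?U" for X Y
  proof -
    obtain E F where "X = (\<Union>i\<in>E. B i)" "Y = (\<Union>i\<in>F. B i)" "finite E" "finite F"
      using XY by auto
    then show ?thesis by (intro image_eqI[of _ _ "E \<union> F"]) auto
  qed
  show "?U \<subseteq> sets \<eta>" using B_open by (auto simp: prob_measuresD[OF \<eta>])
  show "sets (H n) = sets \<eta>" for n by (simp add: prob_measuresD[OF \<eta>] prob_measuresD[OF H])
  show "V = \<Union>{X \<in> ?U. X \<subseteq> V}"
  proof (intro subset_antisym subsetI)
    fix x assume "x \<in> V"
    then obtain n where n: "x \<in> B n" "B n \<subseteq> V" using B_base[OF V] by blast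
    then have "B n \<in> {X \<in> ?U. X \<subseteq> V}" by (auto intro!: image_eqI[of _ _ "{n}"])
    then show "x \<in> \<Union>{X \<in> ?U. X \<subseteq> V}" using n(1) by blast
  qed auto
  show "emeasure \<eta> X \<le> liminf (\<lambda>n. emeasure (H n) X)" if "X \<in> ?U" for X
    using that le by auto
qed

section \<open>The limit of a sequence of couplings\<close>

text \<open>Inner regularity of the full-measure set \<open>- N\<close>.\<close>

lemma compact_in_conull_setE:
  fixes M :: "'a::polish_space measure"
  assumes M: "M \<in> prob_measures" and N: "N \<in> null_sets M" and d: "0 < (d::real)"
  obtains K where "K \<subseteq> - N" "compact K" "ennreal (1 - d) < emeasure M K"
proof -
  note DM = prob_measuresD[OF M]
  interpret M: prob_space M by (rule DM)
  have "N \<in> sets borel" using N DM by auto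
  then have "- N \<in> sets borel" by (rule borel_comp)
  then have "emeasure M (- N) = (SUP K\<in>{K. K \<subseteq> - N \<and> compact K}. emeasure M K)"
    by (intro inner_regular DM) auto
  moreover have "emeasure M (- N) = 1"
    using M.emeasure_space_1 emeasure_Diff_null_set[OF N, of UNIV] DM by (simp add: Compl_eq_Diff_UNIV)
  moreover have "ennreal (1 - d) < 1" using d by (simp add: ennreal_less_one_iff)
  ultimately have "ennreal (1 - d) < (SUP K\<in>{K. K \<subseteq> - N \<and> compact K}. emeasure M K)"
    by simp
  then show ?thesis unfolding less_SUP_iff using that by blast
qed

text \<open>This gives continuity at the empty set for the limit of the couplings. On a compact
  rectangle avoiding \<open>N\<close>, every \<open>X k\<close> coincides with its closure, so
  compactness makes some \<open>X k\<close> miss the rectangle. The mass outside is controlled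
  through the marginals alone.\<close>

lemma couplings_decseq_eventually_small:
  fixes \<eta> \<nu> :: "'a::polish_space measure"
  assumes \<eta>: "\<eta> \<in> prob_measures" and \<nu>: "\<nu> \<in> prob_measures"
    and H: "\<And>n::nat. H n \<in> prob_measures"
    and \<pi>: "\<And>n. \<pi> n \<in> couplings (H n) \<nu>"
    and le: "\<And>V. open V \<Longrightarrow> emeasure \<eta> V \<le> liminf (\<lambda>n. emeasure (H n) V)"
    and N: "N \<in> null_sets \<eta>" "N \<in> null_sets \<nu>"
    and X: "\<And>k. X k \<in> sets borel" "\<And>k. frontier (X k) \<subseteq> {(x, y). x \<in> N \<or> y \<in> N}"
    and decX: "decseq X" "(\<Inter>k. X k) = {}" and d: "0 < (d::real)"
  shows "\<exists>k. \<forall>\<^sub>F n in sequentially. emeasure (\<pi> n) (X k) \<le> ennreal (2 * d)"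
proof -
  note D\<eta> = prob_measuresD[OF \<eta>] and D\<nu> = prob_measuresD[OF \<nu>] and DH = prob_measuresD[OF H]
  note D\<pi> = couplingsD[OF \<pi>]
  interpret \<nu>: prob_space \<nu> by (rule D\<nu>)
  obtain K where K: "K \<subseteq> - N" "compact K" "ennreal (1 - d) < emeasure \<eta> K"
    using compact_in_conull_setE[OF \<eta> N(1) d] .
  obtain L where L: "L \<subseteq> - N" "compact L" "ennreal (1 - d) < emeasure \<nu> L"
    using compact_in_conull_setE[OF \<nu> N(2) d] .
  \<comment> \<open>A point of the rectangle has both coordinates outside \<open>N\<close>, so it
    lies on no frontier.\<close>
  have closed_in_KL: "K \<times> L \<inter> X k = K \<times> L \<inter> closure (X k)" for k
    using K(1) L(1) X(2)[of k] by (fastforce simp: closure_Un_frontier)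
  have "\<exists>k. K \<times> L \<inter> X k = {}"
  proof (rule ccontr)
    assume "\<not> ?thesis"
    then have ne: "K \<times> L \<inter> closure (X k) \<noteq> {}" for k using closed_in_KL[of k] by blast
    have "K \<times> L \<inter> (\<Inter>k. closure (X k)) \<noteq> {}"
    proof (rule compact_imp_fip_image)
      show "compact (K \<times> L)" using K(2) L(2) by (rule compact_Times)
      show "K \<times> L \<inter> (\<Inter>i\<in>I. closure (X i)) \<noteq> {}" if I: "finite I" for I
      proof -
        \<comment> \<open>Inserting 0 keeps \<open>Max\<close> meaningful when \<open>I\<close> is
          empty.\<close>
        have "closure (X (Max (insert 0 I))) \<subseteq> closure (X i)" if "i \<in> I" for i
          using decX(1) that I by (intro closure_mono) (auto simp: decseq_def)
        then show ?thesis using ne[of "Max (insert 0 I)"] by blast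
      qed
    qed auto
    then have "(\<Inter>k. K \<times> L \<inter> X k) \<noteq> {}" unfolding closed_in_KL by blast
    then show False using decX(2) by auto
  qed
  then obtain k where k: "K \<times> L \<inter> closure (X k) = {}" using closed_in_KL by blast
  \<comment> \<open>Only open sets have their mass under \<open>H n\<close> bounded below, so
    \<open>K\<close> is enlarged to an open \<open>W\<close>. The compact \<open>L\<close> may stay,
    since the second marginal is always \<nu>.\<close>
  obtain W V where WV: "open W" "K \<subseteq> W" "L \<subseteq> V" "W \<times> V \<subseteq> - closure (X k)"
  proof (rule Wallace_theorem_prod_topology[of euclidean K euclidean L "- closure (X k)"])
    show "openin (prod_topology euclidean euclidean) (- closure (X k))"
      by (simp add: open_Compl)
  qed (use k K L in auto)
  then have W: "W \<times> L \<inter> X k = {}"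
    using closure_subset[of "X k"] by blast
  have "ennreal (1 - d) < emeasure \<eta> K" by fact
  also have "\<dots> \<le> emeasure \<eta> W" using WV(1,2) D\<eta> by (intro emeasure_mono) auto
  also have "\<dots> \<le> liminf (\<lambda>n. emeasure (H n) W)" by (rule le[OF WV(1)])
  finally have "\<forall>\<^sub>F n in sequentially. ennreal (1 - d) < emeasure (H n) W"
    by (rule less_LiminfD)
  then have "\<forall>\<^sub>F n in sequentially. emeasure (\<pi> n) (X k) \<le> ennreal (2 * d)"
  proof eventually_elim
    case (elim n)
    interpret Hn: prob_space "H n" by (rule DH)
    interpret \<pi>n: prob_space "\<pi> n" by (rule D\<pi>)
    have Ls: "L \<in> sets borel" using L(2) by (simp add: compact_imp_closed)
    have sets: "(- W) \<times> UNIV \<in> sets borel" "UNIV \<times> (- L) \<in> sets borel"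
      using WV(1) Ls by (auto intro!: borel_Times borel_comp)
    have small: "measure M (- A) < d"
      if M: "M \<in> prob_measures" and A: "A \<in> sets borel" "ennreal (1 - d) < emeasure M A" for M and A :: "'a set"
    proof -
      interpret M: prob_space M by (rule prob_measuresD[OF M])
      \<comment> \<open>For \<open>d > 1\<close> the coercion \<open>ennreal (1 - d)\<close> is
        truncated to 0, so that case uses only that measures are nonnegative.\<close>
      have "1 - d < measure M A"
        using A(2) by (cases "1 - d < 0") (auto simp: M.emeasure_eq_measure ennreal_less_iff
          intro: less_le_trans[OF _ measure_nonneg])
      then show ?thesis
        using M.prob_compl[of A] A(1) prob_measuresD[OF M] by (simp add: Compl_eq_Diff_UNIV)
    qed
    have "emeasure (\<pi> n) (X k) \<le> emeasure (\<pi> n) ((- W) \<times> UNIV \<union> UNIV \<times> (- L))"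
      using W by (intro emeasure_mono) (auto simp: D\<pi> intro!: sets.Un sets)
    also have "\<dots> \<le> emeasure (\<pi> n) ((- W) \<times> UNIV) + emeasure (\<pi> n) (UNIV \<times> (- L))"
      by (intro emeasure_subadditive) (auto simp: D\<pi> sets)
    also have "\<dots> = emeasure (H n) (- W) + emeasure \<nu> (- L)"
      using WV(1) Ls by (simp add: emeasure_coupling_fst[OF \<pi>] emeasure_coupling_snd[OF \<pi>] borel_comp)
    also have "\<dots> \<le> ennreal d + ennreal d"
      using small[OF H, of W n] small[OF \<nu> Ls L(3)] elim WV(1)
      by (intro add_mono) (auto simp: Hn.emeasure_eq_measure \<nu>.emeasure_eq_measure ennreal_leI)
    finally show ?case using d by (simp flip: ennreal_plus)
  qed
  then show ?thesis by blast
qed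

text \<open>Limits along a subsequence define a finitely additive set function on a countable
  algebra. The preceding lemma makes it continuous at the empty set, so it extends to a measure,
  whose marginals are then identified by one-sided inequalities on open sets.\<close>

lemma coupling_convergent_subseq:
  fixes \<eta> \<nu> :: "'a::polish_space measure" and B :: "nat \<Rightarrow> 'a set"
  assumes \<eta>: "\<eta> \<in> prob_measures" and \<nu>: "\<nu> \<in> prob_measures"
    and H: "\<And>n::nat. H n \<in> prob_measures"
    and \<pi>: "\<And>n. \<pi> n \<in> couplings (H n) \<nu>"
    and B_open: "\<And>n. open (B n)"
    and B_null: "\<And>n. emeasure \<eta> (frontier (B n)) = 0" "\<And>n. emeasure \<nu> (frontier (B n)) = 0"
    and B_base: "\<And>U x. open U \<Longrightarrow> x \<in> U \<Longrightarrow> \<exists>n. x \<in> B n \<and> B n \<subseteq> U"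
    and le: "\<And>V. open V \<Longrightarrow> emeasure \<eta> V \<le> liminf (\<lambda>n. emeasure (H n) V)"
  obtains P r where "P \<in> couplings \<eta> \<nu>" "strict_mono (r :: nat \<Rightarrow> nat)"
    "\<And>V. open V \<Longrightarrow> emeasure P V \<le> liminf (\<lambda>n. emeasure (\<pi> (r n)) V)"
proof -
  note D\<eta> = prob_measuresD[OF \<eta>] and D\<nu> = prob_measuresD[OF \<nu>]
  note D\<pi> = couplingsD[OF \<pi>]
  define A :: "bool \<times> nat \<Rightarrow> ('a \<times> 'a) set"
    where "A = (\<lambda>(b, n). if b then B n \<times> UNIV else UNIV \<times> B n)"
  define G where "G = range (bool_set A)"
  define N where "N = (\<Union>n. frontier (B n))"
  interpret G: algebra UNIV G unfolding G_def by (rule algebra_bool_set)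
  have A_open: "open (A i)" for i
    using B_open by (cases i) (auto simp: A_def open_Times)
  have G_count: "countable G" by (simp add: G_def)
  have A_in_G: "A i \<in> G" for i unfolding G_def by (rule range_eqI[of _ _ "Atom i"]) simp
  have G_sets: "X \<in> sets borel" if "X \<in> G" for X
    using that bool_set_in_sets[of A] A_open by (auto simp: G_def)
  \<comment> \<open>The frontier of a cylinder is the cylinder over the frontier of its base, which
    lies in the common null set \<open>N\<close>.\<close>
  have G_frontier: "frontier X \<subseteq> {(x, y). x \<in> N \<or> y \<in> N}" if X: "X \<in> G" for X
  proof -
    have "frontier (A (b, n)) \<subseteq> {(x, y). x \<in> N \<or> y \<in> N}" for b n
      by (cases b) (auto simp: A_def frontier_def closure_Times interior_Times N_def)
    then have "(\<Union>i. frontier (A i)) \<subseteq> {(x, y). x \<in> N \<or> y \<in> N}" by fastforce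
    moreover obtain e where "X = bool_set A e" using X by (auto simp: G_def)
    ultimately show ?thesis using frontier_bool_set_subset[of A e] by simp
  qed
  \<comment> \<open>Rectangles \<open>B i \<times> B j\<close> are intersections of two cylinders,
    hence belong to \<open>G\<close>, and they form a base of the product topology.\<close>
  have G_base: "V = \<Union>{X \<in> G. X \<subseteq> V}" if V: "open V" for V
  proof
    show "V \<subseteq> \<Union>{X \<in> G. X \<subseteq> V}"
    proof
      fix z assume "z \<in> V"
      then obtain V1 V2 where V12: "open V1" "open V2" "z \<in> V1 \<times> V2" "V1 \<times> V2 \<subseteq> V"
        using V by (metis open_prod_elim)
      obtain i where i: "fst z \<in> B i" "B i \<subseteq> V1" using B_base[OF V12(1), of "fst z"] V12(3) by auto
      obtain j where j: "snd z \<in> B j" "B j \<subseteq> V2" using B_base[OF V12(2), of "snd z"] V12(3) by auto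
      have "A (True, i) \<inter> A (False, j) \<in> G" by (intro G.Int A_in_G)
      moreover have "A (True, i) \<inter> A (False, j) = B i \<times> B j" by (auto simp: A_def)
      moreover have "z \<in> B i \<times> B j" "B i \<times> B j \<subseteq> V" using i j V12(4) by (auto simp: mem_Times_iff)
      ultimately show "z \<in> \<Union>{X \<in> G. X \<subseteq> V}" by auto
    qed
  qed auto
  have \<pi>_ps: "prob_space (\<pi> n)" for n by (rule D\<pi>)
  obtain r l where r: "strict_mono (r :: nat \<Rightarrow> nat)"
    and l: "\<And>e. (\<lambda>n. measure (\<pi> (r n)) (bool_set A e)) \<longlonglongrightarrow> l e"
  proof (rule pointwise_convergent_subseqE[of "\<lambda>n e. measure (\<pi> n) (bool_set A e)"])
    show "measure (\<pi> n) (bool_set A e) \<in> {0..1}" for n e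
      using prob_space.prob_le_1[OF \<pi>_ps] by simp
  qed (use that in blast)
  \<comment> \<open>Passing to a subsequence can only raise the liminf.\<close>
  have le_r: "emeasure \<eta> V \<le> liminf (\<lambda>n. emeasure (H (r n)) V)" if "open V" for V
    using le[OF that] liminf_subseq_mono[OF r, of "\<lambda>n. emeasure (H n) V"] by (simp add: o_def)
  have N_null: "N \<in> null_sets \<eta>" "N \<in> null_sets \<nu>"
    unfolding N_def by (intro null_sets_UN; simp add: null_sets_def B_null D\<eta> D\<nu>)+
  have emeas: "emeasure (\<pi> n) X = ennreal (measure (\<pi> n) X)" for n X
    using \<pi>_ps by (simp add: finite_measure.emeasure_eq_measure prob_space_def)
  define f where "f X = lim (\<lambda>n. emeasure (\<pi> (r n)) X)" for X
  have f: "(\<lambda>n. emeasure (\<pi> (r n)) X) \<longlonglongrightarrow> f X" if X: "X \<in> G" for X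
  proof -
    obtain e where "X = bool_set A e" using X by (auto simp: G_def)
    then have "(\<lambda>n. emeasure (\<pi> (r n)) X) \<longlonglongrightarrow> ennreal (l e)"
      using l[of e] by (auto simp: emeas intro: tendsto_ennrealI)
    then show ?thesis unfolding f_def by (simp add: limI)
  qed
  have f_le: "f X \<le> f Y" if "X \<in> G" "Y \<in> G" "X \<subseteq> Y" for X Y
    using that G_sets D\<pi> by (intro LIMSEQ_le[OF f f] exI[of _ 0] allI impI emeasure_mono) auto
  have f_UNIV: "f UNIV = 1"
  proof -
    have "emeasure (\<pi> n) UNIV = 1" for n
      using prob_space.emeasure_space_1[OF \<pi>_ps] by (simp add: D\<pi>)
    then show ?thesis using f[of UNIV] G.top LIMSEQ_unique[OF tendsto_const] by fastforce
  qed
  have f_cont: "(\<lambda>k. f (X k)) \<longlonglongrightarrow> 0" if X: "range X \<subseteq> G" "decseq X" "(\<Inter>k. X k) = {}" for X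
  proof -
    have XG: "X k \<in> G" for k using X(1) by auto
    have small: "\<exists>k. f (X k) \<le> ennreal (2 * d)" if d: "0 < d" for d :: real
    proof -
      have "\<exists>k. \<forall>\<^sub>F n in sequentially. emeasure (\<pi> (r n)) (X k) \<le> ennreal (2 * d)"
        using le_r N_null XG by (intro couplings_decseq_eventually_small[OF \<eta> \<nu> H \<pi>, of r N] X d G_sets G_frontier)
      then obtain k where k: "\<forall>\<^sub>F n in sequentially. emeasure (\<pi> (r n)) (X k) \<le> ennreal (2 * d)" ..
      have "f (X k) \<le> ennreal (2 * d)"
        by (rule tendsto_upperbound[OF f[OF XG] k]) simp
      then show ?thesis by blast
    qed
    show ?thesis
    proof (rule order_tendstoI)
      fix a :: ennreal assume "0 < a"
      then obtain e where e: "0 < e" "ennreal e < a"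
        by (metis ennreal_less_zero_iff dense ennreal_cases top.not_eq_extremum not_less_iff_gr_or_eq)
      then obtain k where k: "f (X k) \<le> ennreal e" using small[of "e / 2"] by auto
      show "\<forall>\<^sub>F n in sequentially. f (X n) < a"
        using eventually_ge_at_top[of k]
      proof eventually_elim
        case (elim n)
        have "f (X n) \<le> f (X k)" using X(2) elim by (intro f_le XG) (auto simp: decseq_def)
        then show ?case using k e by (meson le_less_trans)
      qed
    qed auto
  qed
  have f_pos: "positive G f"
  proof -
    have "f {} = 0" using f[of "{}"] LIMSEQ_unique[OF tendsto_const] by fastforce
    then show ?thesis by (simp add: positive_def)
  qed
  have f_add: "additive G f"
    unfolding additive_def
  proof safe
    fix X Y assume XY: "X \<in> G" "Y \<in> G" "X \<inter> Y = {}"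
    have "(\<lambda>n. emeasure (\<pi> (r n)) X + emeasure (\<pi> (r n)) Y) \<longlonglongrightarrow> f X + f Y"
      by (intro tendsto_add f XY)
    moreover have "emeasure (\<pi> (r n)) X + emeasure (\<pi> (r n)) Y = emeasure (\<pi> (r n)) (X \<union> Y)" for n
      using XY G_sets D\<pi> by (intro plus_emeasure) auto
    ultimately show "f (X \<union> Y) = f X + f Y"
      using f[of "X \<union> Y"] XY LIMSEQ_unique by (simp add: G.Un) blast
  qed
  have f_fin: "f X \<noteq> \<infinity>" if "X \<in> G" for X
    using f_le[OF that G.top] f_UNIV by (auto simp: top_unique)
  obtain m where m: "\<And>X. X \<in> G \<Longrightarrow> m X = f X" "measure_space UNIV (sigma_sets UNIV G) m"
    using G.caratheodory_empty_continuous[OF f_pos f_add f_fin f_cont] by blast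
  have borel_G: "sigma_sets UNIV G = sets (borel :: ('a \<times> 'a) measure)"
  proof
    show "sigma_sets UNIV G \<subseteq> sets borel"
      using G_sets sets.sigma_sets_subset[of G "borel :: ('a \<times> 'a) measure"] by auto
    have "V \<in> sigma_sets UNIV G" if "open V" for V
    proof -
      have "\<Union>{X \<in> G. X \<subseteq> V} \<in> sigma_sets UNIV G"
        using G_count by (intro sigma_sets_UNION) (auto intro: countable_subset)
      then show ?thesis using G_base[OF that] by simp
    qed
    then show "sets borel \<subseteq> sigma_sets UNIV G"
      unfolding borel_def by (auto intro!: sigma_sets_mono simp: sets_measure_of)
  qed
  define P where "P = measure_of UNIV (sets borel) m"
  have P_sets: "sets P = sets borel" and P_space: "space P = UNIV"
    using sets.sigma_sets_eq[of "borel :: ('a \<times> 'a) measure"]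
    by (simp_all add: P_def sets_measure_of_conv space_measure_of_conv)
  have P_eq: "emeasure P X = f X" if "X \<in> G" for X
  proof -
    have "emeasure P X = m X"
      unfolding P_def using m(2) G_sets[OF that]
      by (intro emeasure_measure_of_sigma)
         (auto simp: measure_space_def borel_G)
    then show ?thesis using m(1)[OF that] by simp
  qed
  have P_ps: "prob_space P"
    by (rule prob_spaceI) (simp add: P_space P_eq f_UNIV)
  have P_le: "emeasure P V \<le> liminf (\<lambda>n. emeasure (\<pi> (r n)) V)" if V: "open V" for V
  proof (rule emeasure_le_liminf_if_base[OF G_count _ _ _ _ _ G_base[OF V]])
    show "emeasure P X \<le> liminf (\<lambda>n. emeasure (\<pi> (r n)) X)" if "X \<in> G" for X
      using lim_imp_Liminf[OF _ f[OF that]] P_eq[OF that] by simp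
  qed (use G_sets P_sets D\<pi> in auto)
  note P_fst = emeasure_distr_fst[OF P_sets] and P_snd = emeasure_distr_snd[OF P_sets]
  have P1: "distr P borel fst \<in> prob_measures" and P2: "distr P borel snd \<in> prob_measures"
    using P_ps unfolding prob_measures_def
    by (auto intro!: prob_space.prob_space_distr simp: measurable_cong_sets[OF P_sets refl]
        borel_measurable_continuous_onI continuous_on_fst continuous_on_snd)
  \<comment> \<open>Here \<open>P_le\<close> bounds the marginal above: the cylinder over
    \<open>V\<close> has mass \<open>emeasure \<nu> V\<close> under every
    \<open>\<pi> (r n)\<close>.\<close>
  have "distr P borel snd = \<nu>"
  proof (rule prob_measure_eqI_le_open[OF P2 \<nu>])
    fix V :: "'a set" assume V: "open V"
    have "emeasure (distr P borel snd) V = emeasure P (UNIV \<times> V)" using V by (simp add: P_snd)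
    also have "\<dots> \<le> liminf (\<lambda>n. emeasure (\<pi> (r n)) (UNIV \<times> V))"
      using V by (intro P_le open_Times) auto
    also have "\<dots> = emeasure \<nu> V"
      using V emeasure_coupling_snd[OF \<pi>, of V] by (simp add: Liminf_const)
    finally show "emeasure (distr P borel snd) V \<le> emeasure \<nu> V" .
  qed
  \<comment> \<open>The inequality now goes the other way, since \<open>H n\<close> is bounded only
    below. On cylinders in \<open>G\<close> the couplings converge to \<open>P\<close> exactly,
    which gives the bound for a base of open sets; the constant sequence in the liminf brings it to
    the form of the base lemma.\<close>
  moreover have "\<eta> = distr P borel fst"
  proof (rule prob_measure_eqI_le_open[OF \<eta> P1])
    fix V :: "'a set" assume V: "open V"
    let ?U = "{X. open X \<and> X \<times> UNIV \<in> G}"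
    have "emeasure \<eta> V \<le> liminf (\<lambda>n::nat. emeasure (distr P borel fst) V)"
    proof (rule emeasure_le_liminf_if_base[of ?U])
      \<comment> \<open>Projecting recovers each set from its cylinder, so countability passes from
        \<open>G\<close> to \<open>?U\<close>.\<close>
      have "X = fst ` (X \<times> UNIV)" for X :: "'a set" by auto
      then have "?U \<subseteq> image fst ` G" by blast
      then show "countable ?U" using G_count by (rule countable_subset[OF _ countable_image])
      show "{} \<in> ?U" by auto
      show "X \<union> Y \<in> ?U" if "X \<in> ?U" "Y \<in> ?U" for X Y
        using that by (auto simp: Sigma_Un_distrib1 intro: open_Un)
      show "?U \<subseteq> sets \<eta>" by (auto simp: D\<eta>)
      show "V = \<Union>{X \<in> ?U. X \<subseteq> V}"
      proof (intro subset_antisym subsetI)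
        fix x assume "x \<in> V"
        then obtain n where n: "x \<in> B n" "B n \<subseteq> V" using B_base[OF V] by blast
        then have "B n \<in> {X \<in> ?U. X \<subseteq> V}" using B_open A_in_G[of "(True, n)"] by (simp add: A_def)
        then show "x \<in> \<Union>{X \<in> ?U. X \<subseteq> V}" using n(1) by blast
      qed auto
      fix X assume "X \<in> ?U"
      then have X_open: "open X" and XG: "X \<times> UNIV \<in> G" by auto
      have "emeasure \<eta> X \<le> liminf (\<lambda>n. emeasure (H (r n)) X)" by (rule le_r[OF X_open])
      also have "\<dots> = liminf (\<lambda>n. emeasure (\<pi> (r n)) (X \<times> UNIV))"
        using emeasure_coupling_fst[OF \<pi>, of X] X_open by simp
      also have "\<dots> = emeasure P (X \<times> UNIV)"
        using lim_imp_Liminf[OF _ f[OF XG]] P_eq[OF XG] by simp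
      also have "\<dots> = emeasure (distr P borel fst) X" using X_open by (simp add: P_fst)
      finally show "emeasure \<eta> X \<le> liminf (\<lambda>n::nat. emeasure (distr P borel fst) X)"
        by (simp add: Liminf_const)
    qed (simp add: D\<eta>)
    then show "emeasure \<eta> V \<le> emeasure (distr P borel fst) V" by (simp add: Liminf_const)
  qed
  ultimately have "P \<in> couplings \<eta> \<nu>" by (simp add: couplings_def P_sets P_ps)
  then show ?thesis using r P_le that by blast
qed

section \<open>Weak lower semicontinuity of the transport cost\<close>

text \<open>If no neighbourhood of \<eta> keeps the cost above \<open>t\<close>, measures of cost at
  most \<open>t\<close> can be picked from a sequence of neighbourhoods. Almost optimal couplings of
  these have a limit coupling of \<eta> and \<nu> with cost at most \<open>t\<close>, a
  contradiction.\<close>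

lemma lsc_on_OT_cost:
  fixes c :: "'a::polish_space \<times> 'a \<Rightarrow> ennreal"
  assumes c: "cost_function c" and \<nu>: "\<nu> \<in> prob_measures"
  shows "lsc_on weak_topology (\<lambda>\<eta>. OT_cost c \<eta> \<nu>)"
proof -
  have nbhd: "\<exists>T. openin weak_topology T \<and> \<eta> \<in> T \<and> T \<subseteq> {\<eta> \<in> prob_measures. t < OT_cost c \<eta> \<nu>}"
    if \<eta>: "\<eta> \<in> prob_measures" and t: "t < OT_cost c \<eta> \<nu>" for t \<eta>
  proof (rule ccontr)
    assume no_nbhd: "\<not> ?thesis"
    note D\<eta> = prob_measuresD[OF \<eta>]
    interpret \<eta>: prob_space \<eta> by (rule D\<eta>)
    interpret \<nu>: prob_space \<nu> by (rule prob_measuresD[OF \<nu>])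
    obtain B :: "nat \<Rightarrow> 'a set" where B: "\<And>n. open (B n)"
        "\<And>n. emeasure \<eta> (frontier (B n)) = 0" "\<And>n. emeasure \<nu> (frontier (B n)) = 0"
        "\<And>U x. open U \<Longrightarrow> x \<in> U \<Longrightarrow> \<exists>n. x \<in> B n \<and> B n \<subseteq> U"
      using null_frontier_baseE[OF \<eta>.finite_measure_axioms D\<eta>(1) \<nu>.finite_measure_axioms
          prob_measuresD(1)[OF \<nu>]] by metis
    define U where "U F = (\<Union>i\<in>F. B i)" for F
    \<comment> \<open>Stage \<open>n\<close> imposes finitely many open conditions with slack
      \<open>inverse (real (Suc n))\<close>, so every finite \<open>F\<close> is eventually covered.
      Sets \<open>U F\<close> of zero mass are exempt, because the strict inequality would read
      \<open>0 < 0\<close> at \<eta> itself.\<close>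
    define T where "T n = (\<Inter>F\<in>Pow {..<n}. {P \<in> prob_measures. emeasure \<eta> (U F) = 0 \<or>
        ennreal (measure \<eta> (U F) - inverse (real (Suc n))) < emeasure P (U F)})" for n
    have "openin weak_topology {P \<in> prob_measures. b \<or> a < emeasure P (U F)}" for b a F
    proof (cases b)
      case True
      then show ?thesis using openin_topspace[of weak_topology] by simp
    next
      case False
      have "open (U F)" unfolding U_def using B(1) by auto
      then show ?thesis using False by (simp add: openin_weak_topology_emeasure_greater)
    qed
    then have T_open: "openin weak_topology (T n)" for n
      unfolding T_def by (intro openin_INT2) auto
    have \<eta>_T: "\<eta> \<in> T n" for n
    proof -
      have "ennreal (measure \<eta> (U F) - inverse (real (Suc n))) < emeasure \<eta> (U F)"
        if "emeasure \<eta> (U F) \<noteq> 0" for F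
        using that unfolding \<eta>.emeasure_eq_measure
        by (intro ennreal_lessI) (auto simp: less_le)
      then show ?thesis using \<eta> by (auto simp: T_def)
    qed
    have T_prob: "T n \<subseteq> prob_measures" for n
      unfolding T_def by (rule INF_lower2[of "{}"]) auto
    have "\<exists>P. P \<in> T n \<and> OT_cost c P \<nu> \<le> t" for n
    proof (rule ccontr)
      assume "\<not> ?thesis"
      then have "T n \<subseteq> {\<eta> \<in> prob_measures. t < OT_cost c \<eta> \<nu>}"
        using T_prob[of n] by (auto simp: not_le)
      with no_nbhd T_open[of n] \<eta>_T[of n] show False by blast
    qed
    then obtain H where H: "\<And>n. H n \<in> T n" "\<And>n. OT_cost c (H n) \<nu> \<le> t"
      using choice[of "\<lambda>n P. P \<in> T n \<and> OT_cost c P \<nu> \<le> t"] by blast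
    have H_prob: "H n \<in> prob_measures" for n using H(1)[of n] T_prob[of n] by blast
    \<comment> \<open>The bound \<open>t\<close> is finite, being strictly below a cost, so adding a
      positive amount strictly increases it and near-optimal couplings exist.\<close>
    have "\<exists>p. p \<in> couplings (H n) \<nu> \<and> (\<integral>\<^sup>+ z. c z \<partial>p) < t + ennreal (inverse (real (Suc n)))" for n
    proof -
      have "t < t + ennreal (inverse (real (Suc n)))"
        using t by (cases t) (auto simp flip: ennreal_plus simp: ennreal_less_iff)
      then show ?thesis
        using le_less_trans[OF H(2)[of n]] unfolding OT_cost_def INF_less_iff by blast
    qed
    then obtain p where p: "\<And>n. p n \<in> couplings (H n) \<nu>"
        "\<And>n. (\<integral>\<^sup>+ z. c z \<partial>p n) < t + ennreal (inverse (real (Suc n)))"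
      using choice[of "\<lambda>n p. p \<in> couplings (H n) \<nu> \<and>
        (\<integral>\<^sup>+ z. c z \<partial>p) < t + ennreal (inverse (real (Suc n)))"] by blast
    have le_U: "emeasure \<eta> (U F) \<le> liminf (\<lambda>n. emeasure (H n) (U F))" if F: "finite F" for F
    proof (cases "emeasure \<eta> (U F) = 0")
      case False
      obtain k where k: "F \<subseteq> {..<k}" using F finite_nat_iff_bounded by blast
      let ?a = "\<lambda>n. measure \<eta> (U F) + - inverse (real (Suc n))"
      have "(\<lambda>n. ennreal (?a n)) \<longlonglongrightarrow> ennreal (measure \<eta> (U F))"
        by (intro tendsto_ennrealI LIMSEQ_inverse_real_of_nat_add_minus)
      then have "emeasure \<eta> (U F) = liminf (\<lambda>n. ennreal (?a n))"
        by (simp add: \<eta>.emeasure_eq_measure lim_imp_Liminf)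
      also have "\<dots> \<le> liminf (\<lambda>n. emeasure (H n) (U F))"
      proof (rule Liminf_mono, use eventually_ge_at_top[of k] in eventually_elim)
        case (elim n)
        then have "F \<in> Pow {..<n}" using k by auto
        then show ?case using H(1)[of n] False by (auto simp: T_def less_imp_le)
      qed
      finally show ?thesis .
    qed simp
    have le_open: "emeasure \<eta> V \<le> liminf (\<lambda>n. emeasure (H n) V)" if "open V" for V
      by (rule emeasure_open_le_liminf_if_finite_unions[OF \<eta> H_prob B(1) B(4) le_U[unfolded U_def] that])
    obtain P r where P: "P \<in> couplings \<eta> \<nu>" "strict_mono (r :: nat \<Rightarrow> nat)"
        "\<And>V. open V \<Longrightarrow> emeasure P V \<le> liminf (\<lambda>n. emeasure (p (r n)) V)"
    proof (rule coupling_convergent_subseq[OF \<eta> \<nu> H_prob p(1) B le_open])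
      fix P r
      assume "P \<in> couplings \<eta> \<nu>" "strict_mono (r :: nat \<Rightarrow> nat)"
        "\<And>V. open V \<Longrightarrow> emeasure P V \<le> liminf (\<lambda>n. emeasure (p (r n)) V)"
      then show thesis by (rule that)
    qed
    have prob: "q \<in> prob_measures" if "q \<in> couplings \<alpha> \<beta>" for q and \<alpha> \<beta> :: "'a measure"
      using that by (simp add: prob_measures_def couplings_def)
    have lim: "(\<lambda>n. t + ennreal (inverse (real (Suc n)))) \<longlonglongrightarrow> t + ennreal 0"
      by (intro tendsto_add tendsto_const tendsto_ennrealI LIMSEQ_inverse_real_of_nat)
    have "OT_cost c \<eta> \<nu> \<le> (\<integral>\<^sup>+ z. c z \<partial>P)"
      unfolding OT_cost_def by (rule INF_lower[OF P(1)])
    also have "\<dots> \<le> liminf (\<lambda>n. \<integral>\<^sup>+ z. c z \<partial>p (r n))"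
      using c unfolding cost_function_def
      by (rule nn_integral_lsc_le_liminf[OF _ prob[OF P(1)] prob[OF p(1)] P(3)])
    also have "\<dots> \<le> liminf (\<lambda>n. t + ennreal (inverse (real (Suc (r n)))))"
      using p(2) by (intro Liminf_mono always_eventually allI less_imp_le)
    also have "\<dots> = t"
      using lim_imp_Liminf[OF _ LIMSEQ_subseq_LIMSEQ[OF lim P(2)]] by (simp add: o_def)
    finally show False using t by simp
  qed
  show ?thesis
    unfolding lsc_on_def
  proof
    fix t
    have "openin weak_topology {\<eta> \<in> prob_measures. t < OT_cost c \<eta> \<nu>}"
      by (subst openin_subopen) (use nbhd in blast)
    moreover have "topspace weak_topology - {\<eta> \<in> topspace weak_topology. OT_cost c \<eta> \<nu> \<le> t}
        = {\<eta> \<in> prob_measures. t < OT_cost c \<eta> \<nu>}" by auto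
    ultimately show "closedin weak_topology {\<eta> \<in> topspace weak_topology. OT_cost c \<eta> \<nu> \<le> t}"
      unfolding closedin_def by auto
  qed
qed

section \<open>Sums and minima of lower semicontinuous functions\<close>

text \<open>The sum exceeds \<open>t\<close> exactly when some splitting of \<open>t\<close> is
  exceeded in both parts. This writes a sublevel set of a sum through sublevel sets of the summands,
  using only intersections and finite unions.\<close>

lemma ennreal_add_le_iff_split:
  fixes a b t :: ennreal
  assumes "t < \<infinity>"
  shows "a + b \<le> t \<longleftrightarrow> a \<le> t \<and> b \<le> t \<and> (\<forall>q\<le>t. a \<le> q \<or> b \<le> t - q)"
proof (intro iffI conjI allI impI)
  assume ab: "a + b \<le> t"
  show "a \<le> t" "b \<le> t"
    using ab by (metis add_increasing2 add_increasing order_trans zero_le order_refl)+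
  fix q assume "q \<le> t"
  show "a \<le> q \<or> b \<le> t - q"
    using ab \<open>q \<le> t\<close> assms \<open>a \<le> t\<close> \<open>b \<le> t\<close>
    by (cases a; cases b; cases t; cases q)
      (auto simp flip: ennreal_plus simp: ennreal_minus ennreal_le_iff2 top_unique)
next
  assume *: "a \<le> t \<and> b \<le> t \<and> (\<forall>q\<le>t. a \<le> q \<or> b \<le> t - q)"
  then obtain x y s where xys: "a = ennreal x" "b = ennreal y" "t = ennreal s" "0 \<le> x" "0 \<le> y" "0 \<le> s"
    using assms by (cases a; cases b; cases t) (auto simp: top_unique)
  then have le: "x \<le> s" "y \<le> s" using * by auto
  show "a + b \<le> t"
  proof (rule ccontr)
    assume "\<not> a + b \<le> t"
    then have less: "s < x + y" using xys by (simp flip: ennreal_plus)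
    \<comment> \<open>The midpoint of \<open>s - y\<close> and \<open>x\<close>: if
      \<open>s < x + y\<close>, it lies strictly between them, so both alternatives fail. The bounds
      \<open>x \<le> s\<close> and \<open>y \<le> s\<close> place it in the range from 0 to
      \<open>s\<close>.\<close>
    let ?q = "(x + s - y) / 2"
    have "ennreal ?q \<le> t" using xys le by simp
    then have "a \<le> ennreal ?q \<or> b \<le> t - ennreal ?q" using * by blast
    then show False
      using less le xys by (auto simp: ennreal_minus field_simps)
  qed
qed

lemma lsc_on_add:
  assumes "lsc_on T f" "lsc_on T g"
  shows "lsc_on T (\<lambda>x. f x + g x)"
  unfolding lsc_on_def
proof
  fix t :: ennreal
  note closed = assms[unfolded lsc_on_def, rule_format]
  show "closedin T {x \<in> topspace T. f x + g x \<le> t}"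
  proof (cases "t = \<infinity>")
    case False
    then have "t < \<infinity>" by (simp add: less_top)
    have "{x \<in> topspace T. f x + g x \<le> t} = {x \<in> topspace T. f x \<le> t} \<inter> {x \<in> topspace T. g x \<le> t} \<inter>
        (\<Inter>q\<in>{..t}. {x \<in> topspace T. f x \<le> q} \<union> {x \<in> topspace T. g x \<le> t - q})"
      unfolding ennreal_add_le_iff_split[OF \<open>t < \<infinity>\<close>] by auto
    also have "closedin T \<dots>"
      by (intro closedin_Int closedin_INT closedin_Un closed) auto
    finally show ?thesis .
  qed simp
qed

text \<open>The closed sets \<open>?C y\<close> with \<open>y\<close> in \<open>K\<close> have the
  finite intersection property in \<open>K\<close>: among finitely many, the point of least value
  lies in all. A common point minimises \<open>f\<close>. The argument avoids sequences, so it
  applies in any topological space.\<close>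

lemma lsc_on_attains_inf:
  assumes "compactin T K" "K \<noteq> {}" "lsc_on T f"
  shows "\<exists>x\<in>K. \<forall>y\<in>K. f x \<le> f y"
proof -
  have K: "K \<subseteq> topspace T" using assms(1) by (rule compactin_subset_topspace)
  let ?C = "\<lambda>y. {x \<in> topspace T. f x \<le> f y}"
  have "K \<inter> \<Inter>\<F> \<noteq> {}" if \<F>: "finite \<F>" "\<F> \<subseteq> ?C ` K" for \<F>
  proof -
    obtain Y where Y: "finite Y" "Y \<subseteq> K" "\<F> = ?C ` Y"
      using finite_subset_image[OF \<F>] by blast
    show ?thesis
    proof (cases "Y = {}")
      case False
      then obtain y where "y \<in> Y" "\<And>z. z \<in> Y \<Longrightarrow> f y \<le> f z"
        using ex_min_if_finite[of "f ` Y"] Y(1) by (metis (no_types, lifting) arg_min_if_finite(1) arg_min_least)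
      then show ?thesis using K Y by blast
    qed (use Y assms(2) in auto)
  qed
  moreover have "closedin T C" if "C \<in> ?C ` K" for C
    using that assms(3) by (auto simp: lsc_on_def)
  ultimately have "K \<inter> \<Inter>(?C ` K) \<noteq> {}"
    using assms(1) unfolding compactin_fip by (metis (no_types, lifting))
  then show ?thesis by auto
qed

section \<open>Mixtures of measures and convexity of the transport cost\<close>

lemma sets_mix_measure [simp]: "sets (mix_measure t P Q) = sets borel"
  and space_mix_measure [simp]: "space (mix_measure t P Q) = UNIV"
  using sets.sigma_sets_eq[of borel]
  by (simp_all add: mix_measure_def sets_measure_of_conv space_measure_of_conv)

lemma emeasure_mix_measure:
  assumes "sets P = sets borel" "sets Q = sets borel" "A \<in> sets borel"
  shows "emeasure (mix_measure t P Q) A = ennreal t * emeasure P A + ennreal (1 - t) * emeasure Q A"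
  unfolding mix_measure_def
proof (rule emeasure_measure_of_sigma)
  show "sigma_algebra UNIV (sets (borel :: 'a measure))"
    by (metis sets.sigma_algebra_axioms space_borel)
  show "countably_additive (sets borel) (\<lambda>A. ennreal t * emeasure P A + ennreal (1 - t) * emeasure Q A)"
    unfolding countably_additive_def
  proof safe
    fix A :: "nat \<Rightarrow> 'a set" assume A: "range A \<subseteq> sets borel" "disjoint_family A"
    then show "(\<Sum>i. ennreal t * emeasure P (A i) + ennreal (1 - t) * emeasure Q (A i)) =
        ennreal t * emeasure P (\<Union> (range A)) + ennreal (1 - t) * emeasure Q (\<Union> (range A))"
      using assms by (simp add: suminf_emeasure flip: suminf_add)
  qed
qed (use assms in \<open>auto simp: positive_def\<close>)

lemma ennreal_convex_comb_self:
  assumes "0 \<le> t" "t \<le> 1"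
  shows "ennreal t * x + ennreal (1 - t) * x = x"
  using assms by (simp flip: distrib_right ennreal_plus)

lemma mix_measure_in_prob_measures:
  assumes "P \<in> prob_measures" "Q \<in> prob_measures" "0 \<le> t" "t \<le> 1"
  shows "mix_measure t P Q \<in> prob_measures"
proof -
  note P = prob_measuresD[OF assms(1)] and Q = prob_measuresD[OF assms(2)]
  have "emeasure (mix_measure t P Q) UNIV = 1"
    using P Q prob_space.emeasure_space_1[OF P(2)] prob_space.emeasure_space_1[OF Q(2)]
      ennreal_convex_comb_self[OF assms(3,4), of 1] by (simp add: emeasure_mix_measure)
  then show ?thesis by (simp add: prob_measures_def prob_spaceI)
qed

text \<open>The layer cake formula reduces linearity in the measure to the masses of superlevel
  sets, where it is the definition of the mixture.\<close>

lemma nn_integral_mix_measure: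
  assumes PQ: "P \<in> prob_measures" "Q \<in> prob_measures" and t: "0 \<le> t" "t \<le> 1"
    and f: "f \<in> borel_measurable borel"
  shows "(\<integral>\<^sup>+ z. f z \<partial>mix_measure t P Q) = ennreal t * (\<integral>\<^sup>+ z. f z \<partial>P) + ennreal (1 - t) * (\<integral>\<^sup>+ z. f z \<partial>Q)"
proof -
  have R: "(\<integral>\<^sup>+ z. f z \<partial>R) = (\<integral>\<^sup>+ s. indicator {0..} s * emeasure R {z. ennreal s < f z} \<partial>lborel)"
      "(\<lambda>s. emeasure R {z. ennreal s < f z}) \<in> borel_measurable borel"
    if "R \<in> prob_measures" for R
  proof -
    note DR = prob_measuresD[OF that]
    have "f \<in> borel_measurable R" using f measurable_cong_sets[OF DR(1) refl] by blast
    moreover have "sigma_finite_measure R" using DR(2) by (rule prob_space_imp_sigma_finite)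
    ultimately show "(\<integral>\<^sup>+ z. f z \<partial>R) = (\<integral>\<^sup>+ s. indicator {0..} s * emeasure R {z. ennreal s < f z} \<partial>lborel)"
      "(\<lambda>s. emeasure R {z. ennreal s < f z}) \<in> borel_measurable borel"
      using nn_integral_layer_cake[of R f] measurable_emeasure_superlevel[of R f] DR by auto
  qed
  note [measurable] = R(2)[OF PQ(1)] R(2)[OF PQ(2)]
  have "{z. ennreal s < f z} \<in> sets borel" for s
  proof -
    have "{z \<in> space borel. ennreal s < f z} \<in> sets borel" using f by measurable
    then show ?thesis by simp
  qed
  then have "(\<integral>\<^sup>+ z. f z \<partial>mix_measure t P Q) = (\<integral>\<^sup>+ s. ennreal t * (indicator {0..} s * emeasure P {z. ennreal s < f z})
      + ennreal (1 - t) * (indicator {0..} s * emeasure Q {z. ennreal s < f z}) \<partial>lborel)"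
    unfolding R(1)[OF mix_measure_in_prob_measures[OF PQ t]]
    by (intro nn_integral_cong)
      (simp add: emeasure_mix_measure prob_measuresD[OF PQ(1)] prob_measuresD[OF PQ(2)] distrib_left mult_ac)
  also have "\<dots> = ennreal t * (\<integral>\<^sup>+ z. f z \<partial>P) + ennreal (1 - t) * (\<integral>\<^sup>+ z. f z \<partial>Q)"
    unfolding R(1)[OF PQ(1)] R(1)[OF PQ(2)] by (simp add: nn_integral_add nn_integral_cmult)
  finally show ?thesis .
qed

lemma distr_mix_measure:
  assumes "sets P = sets borel" "sets Q = sets borel" "f \<in> measurable borel borel"
  shows "distr (mix_measure t P Q) borel f = mix_measure t (distr P borel f) (distr Q borel f)"
proof (rule measure_eqI)
  fix A assume "A \<in> sets (distr (mix_measure t P Q) borel f)"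
  then have A: "A \<in> sets borel" by simp
  have f: "f \<in> measurable R borel" if "sets R = sets borel" for R
    using assms(3) measurable_cong_sets[OF that refl] by blast
  have "f -` A \<in> sets borel" using measurable_sets[OF assms(3) A] by simp
  moreover have "space P = UNIV" "space Q = UNIV"
    using assms(1,2)[THEN sets_eq_imp_space_eq] by auto
  ultimately show "emeasure (distr (mix_measure t P Q) borel f) A = emeasure (mix_measure t (distr P borel f) (distr Q borel f)) A"
    using assms A by (simp add: emeasure_distr f emeasure_mix_measure)
qed simp

lemma mix_measure_self:
  assumes "sets P = sets borel" "0 \<le> t" "t \<le> 1"
  shows "mix_measure t P P = P"
  using assms by (intro measure_eqI) (auto simp: emeasure_mix_measure ennreal_convex_comb_self)

text \<open>Taking marginals commutes with mixing, and the mixture of \<nu> with itself is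
  \<nu>.\<close>

lemma mix_measure_couplings:
  fixes \<pi> \<rho> :: "('a::polish_space \<times> 'a) measure"
  assumes \<pi>: "\<pi> \<in> couplings P \<nu>" and \<rho>: "\<rho> \<in> couplings Q \<nu>" and t: "0 \<le> t" "t \<le> 1"
  shows "mix_measure t \<pi> \<rho> \<in> couplings (mix_measure t P Q) \<nu>"
proof -
  note D\<pi> = couplingsD[OF \<pi>] and D\<rho> = couplingsD[OF \<rho>]
  have "mix_measure t \<pi> \<rho> \<in> prob_measures"
    using D\<pi> D\<rho> t by (intro mix_measure_in_prob_measures) (auto simp: prob_measures_def)
  moreover have "sets \<nu> = sets borel" using D\<pi>(5) by auto
  moreover have "(fst :: 'a \<times> 'a \<Rightarrow> 'a) \<in> measurable borel borel" "(snd :: 'a \<times> 'a \<Rightarrow> 'a) \<in> measurable borel borel"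
    by (intro borel_measurable_continuous_onI continuous_intros)+
  ultimately show ?thesis
    using D\<pi> D\<rho> t by (simp add: couplings_def prob_measures_def distr_mix_measure mix_measure_self)
qed

text \<open>Couplings within \<open>e\<close> of optimal exist because both costs are finite. Their
  mixture couples the mixed first marginal with \<nu>, and since the weights sum to 1 the total
  error is again \<open>e\<close>.\<close>

lemma OT_cost_mix_measure_le:
  fixes c :: "'a::polish_space \<times> 'a \<Rightarrow> ennreal"
  assumes c: "cost_function c" and t: "0 \<le> t" "t \<le> 1"
    and fin: "OT_cost c P \<nu> < \<infinity>" "OT_cost c Q \<nu> < \<infinity>"
  shows "OT_cost c (mix_measure t P Q) \<nu> \<le> ennreal t * OT_cost c P \<nu> + ennreal (1 - t) * OT_cost c Q \<nu>"
proof (rule ennreal_le_epsilon)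
  fix e :: real assume e: "0 < e"
  have approx: "\<exists>p\<in>couplings R \<nu>. (\<integral>\<^sup>+ z. c z \<partial>p) \<le> OT_cost c R \<nu> + ennreal e"
    if "OT_cost c R \<nu> < \<infinity>" for R
  proof -
    have "OT_cost c R \<nu> < OT_cost c R \<nu> + ennreal e"
      using that e by (cases "OT_cost c R \<nu>") (auto simp flip: ennreal_plus simp: ennreal_less_iff)
    then have "\<exists>p\<in>couplings R \<nu>. (\<integral>\<^sup>+ z. c z \<partial>p) < OT_cost c R \<nu> + ennreal e"
      by (subst (asm) OT_cost_def) (simp add: INF_less_iff)
    then show ?thesis using less_imp_le by blast
  qed
  obtain \<pi> where \<pi>: "\<pi> \<in> couplings P \<nu>" "(\<integral>\<^sup>+ z. c z \<partial>\<pi>) \<le> OT_cost c P \<nu> + ennreal e"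
    using approx[OF fin(1)] by blast
  obtain \<rho> where \<rho>: "\<rho> \<in> couplings Q \<nu>" "(\<integral>\<^sup>+ z. c z \<partial>\<rho>) \<le> OT_cost c Q \<nu> + ennreal e"
    using approx[OF fin(2)] by blast
  have "c \<in> borel_measurable borel"
    using c unfolding cost_function_def by (rule borel_measurable_lsc_on) simp
  then have "(\<integral>\<^sup>+ z. c z \<partial>mix_measure t \<pi> \<rho>) = ennreal t * (\<integral>\<^sup>+ z. c z \<partial>\<pi>) + ennreal (1 - t) * (\<integral>\<^sup>+ z. c z \<partial>\<rho>)"
    using couplingsD[OF \<pi>(1)] couplingsD[OF \<rho>(1)] t
    by (intro nn_integral_mix_measure) (auto simp: prob_measures_def)
  moreover have "OT_cost c (mix_measure t P Q) \<nu> \<le> (\<integral>\<^sup>+ z. c z \<partial>mix_measure t \<pi> \<rho>)"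
    unfolding OT_cost_def by (intro INF_lower mix_measure_couplings \<pi> \<rho> t)
  ultimately have "OT_cost c (mix_measure t P Q) \<nu>
      \<le> ennreal t * (\<integral>\<^sup>+ z. c z \<partial>\<pi>) + ennreal (1 - t) * (\<integral>\<^sup>+ z. c z \<partial>\<rho>)" by simp
  also have "\<dots> \<le> ennreal t * (OT_cost c P \<nu> + ennreal e) + ennreal (1 - t) * (OT_cost c Q \<nu> + ennreal e)"
    using \<pi>(2) \<rho>(2) by (intro add_mono mult_left_mono) auto
  also have "\<dots> = ennreal t * OT_cost c P \<nu> + ennreal (1 - t) * OT_cost c Q \<nu>
      + (ennreal t * ennreal e + ennreal (1 - t) * ennreal e)"
    by (simp add: distrib_left add_ac)
  finally show "OT_cost c (mix_measure t P Q) \<nu>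
      \<le> ennreal t * OT_cost c P \<nu> + ennreal (1 - t) * OT_cost c Q \<nu> + ennreal e"
    by (simp add: ennreal_convex_comb_self[OF t])
qed

section \<open>Existence and uniqueness of the minimiser\<close>

theorem theorem2:
  fixes D :: "'a::polish_space measure \<Rightarrow> 'a measure \<Rightarrow> ennreal"
    and c :: "'a \<times> 'a \<Rightarrow> ennreal"
    and \<mu> \<nu> :: "'a measure"
  assumes "pre_divergence D"
    and "cost_function c"
    and "\<mu> \<in> prob_measures" and "\<nu> \<in> prob_measures"
    and "lsc_on weak_topology (\<lambda>P. D P \<mu>)"
    and "\<forall>M::real. compactin weak_topology {P \<in> prob_measures. D P \<mu> \<le> ennreal M}"
  shows "(\<exists>\<eta>\<in>prob_measures. D_c D c \<nu> \<mu> = D \<eta> \<mu> + OT_cost c \<eta> \<nu>)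
    \<and> (strictly_convex_on_finite (\<lambda>P. D P \<mu>) \<and> D_c D c \<nu> \<mu> < \<infinity> \<longrightarrow>
        (\<exists>!\<eta>. \<eta> \<in> prob_measures \<and> D_c D c \<nu> \<mu> = D \<eta> \<mu> + OT_cost c \<eta> \<nu>))"
proof -
  define h where "h \<eta> = D \<eta> \<mu> + OT_cost c \<eta> \<nu>" for \<eta>
  have Dc: "D_c D c \<nu> \<mu> = (INF \<eta>\<in>prob_measures. h \<eta>)" by (simp add: D_c_def h_def)
  have Dc_le: "D_c D c \<nu> \<mu> \<le> h \<eta>" if "\<eta> \<in> prob_measures" for \<eta>
    unfolding Dc using that by (rule INF_lower)
  have lsc: "lsc_on weak_topology h"
    unfolding h_def[abs_def] by (intro lsc_on_add assms(5) lsc_on_OT_cost assms(2,4))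
  have ex: "\<exists>\<eta>\<in>prob_measures. D_c D c \<nu> \<mu> = h \<eta>"
  proof (cases "D_c D c \<nu> \<mu> = \<infinity>")
    case True
    \<comment> \<open>When the infimum is infinite, every probability measure attains it; \<mu> is
      at hand.\<close>
    then show ?thesis using Dc_le[OF assms(3)] assms(3) by (intro bexI[of _ \<mu>]) (auto simp: top_unique)
  next
    case False
    then obtain \<eta>0 where \<eta>0: "\<eta>0 \<in> prob_measures" "h \<eta>0 < \<infinity>"
      unfolding Dc by (auto simp: less_top INF_less_iff)
    obtain M where M: "h \<eta>0 = ennreal M" using \<eta>0(2) by (cases "h \<eta>0") auto
    \<comment> \<open>The level is the value of \<open>h\<close> at a competitor
      \<open>\<eta>0\<close>. Outside \<open>?K\<close> already \<open>D P \<mu>\<close> exceeds it,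
      so a minimiser over the compact set \<open>?K\<close> is a global one.\<close>
    let ?K = "{P \<in> prob_measures. D P \<mu> \<le> ennreal M}"
    have D_le: "D P \<mu> \<le> h P" for P by (simp add: h_def)
    have \<eta>0K: "\<eta>0 \<in> ?K" using \<eta>0(1) D_le[of \<eta>0] M by simp
    obtain \<eta> where \<eta>: "\<eta> \<in> ?K" "\<And>P. P \<in> ?K \<Longrightarrow> h \<eta> \<le> h P"
      using lsc_on_attains_inf[OF assms(6)[rule_format] _ lsc] \<eta>0K by blast
    have "h \<eta> \<le> h P" if P: "P \<in> prob_measures" for P
    proof (cases "P \<in> ?K")
      case False
      have "h \<eta> \<le> ennreal M" using \<eta>(2)[OF \<eta>0K] M by simp
      also have "\<dots> \<le> h P" using False P D_le[of P] by (auto intro: order_trans less_imp_le)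
      finally show ?thesis .
    qed (rule \<eta>(2))
    then have "h \<eta> \<le> D_c D c \<nu> \<mu>" unfolding Dc by (rule INF_greatest)
    then show ?thesis using \<eta>(1) Dc_le[of \<eta>] by (auto intro: antisym)
  qed
  have unique: "P = Q"
    if conv: "strictly_convex_on_finite (\<lambda>P. D P \<mu>)" and fin: "D_c D c \<nu> \<mu> < \<infinity>"
      and P: "P \<in> prob_measures" "D_c D c \<nu> \<mu> = h P" and Q: "Q \<in> prob_measures" "D_c D c \<nu> \<mu> = h Q" for P Q
  proof (rule ccontr)
    assume "P \<noteq> Q"
    have finQ: "D Q \<mu> < \<infinity>" "OT_cost c Q \<nu> < \<infinity>"
      using fin unfolding Q(2) by (auto simp: h_def)
    have finP: "D P \<mu> < \<infinity>" "OT_cost c P \<nu> < \<infinity>"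
      using fin unfolding P(2) by (auto simp: h_def)
    \<comment> \<open>The midpoint of two distinct minimisers would have a strictly smaller value of
      \<open>h\<close>.\<close>
    let ?R = "mix_measure (1/2) P Q"
    have D_lt: "D ?R \<mu> < ennreal (1/2) * D P \<mu> + ennreal (1 - 1/2) * D Q \<mu>"
      by (rule conv[unfolded strictly_convex_on_finite_def, rule_format, OF P(1) Q(1)])
        (use finP finQ \<open>P \<noteq> Q\<close> in auto)
    have OT_le: "OT_cost c ?R \<nu> \<le> ennreal (1/2) * OT_cost c P \<nu> + ennreal (1 - 1/2) * OT_cost c Q \<nu>"
      using finP finQ by (intro OT_cost_mix_measure_le assms(2)) auto
    \<comment> \<open>Adding the transport cost to the strict inequality for \<open>D\<close> keeps
      it strict only if that cost is finite.\<close>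
    have "ennreal (1/2) * OT_cost c P \<nu> + ennreal (1 - 1/2) * OT_cost c Q \<nu> < \<infinity>"
      using finP finQ by (simp only: ennreal_add_less_top ennreal_mult_less_top ennreal_less_top infinity_ennreal_def simp_thms)
    then have "OT_cost c ?R \<nu> \<noteq> \<infinity>" using OT_le by (auto simp: top_unique)
    then have "h ?R < (ennreal (1/2) * D P \<mu> + ennreal (1 - 1/2) * D Q \<mu>) + OT_cost c ?R \<nu>"
      unfolding h_def using D_lt by (simp only: add.commute[of _ "OT_cost c ?R \<nu>"] ennreal_add_left_cancel_less simp_thms)
    also have "\<dots> \<le> (ennreal (1/2) * D P \<mu> + ennreal (1 - 1/2) * D Q \<mu>)
        + (ennreal (1/2) * OT_cost c P \<nu> + ennreal (1 - 1/2) * OT_cost c Q \<nu>)"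
      using OT_le by (rule add_left_mono)
    also have "\<dots> = ennreal (1/2) * h P + ennreal (1 - 1/2) * h Q"
      by (simp add: h_def distrib_left add_ac)
    also have "\<dots> = D_c D c \<nu> \<mu>"
      unfolding P(2)[symmetric] Q(2)[symmetric] by (rule ennreal_convex_comb_self) auto
    also have "\<dots> \<le> h ?R"
      by (intro Dc_le mix_measure_in_prob_measures P Q) auto
    finally show False by simp
  qed
  show ?thesis
    using ex unique unfolding h_def by blast
qed

end
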